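(* Let $\mathcal{W}$ be the dual space of some normed space, and let $\mathcal{X}\subset\mathcal{Y}$ be a pair of subspaces of $\mathcal{W}$. Assume that $\mathcal{Y}$ admits a Lebesgue decomposition relative to $\mathcal{W}$. Then the following statements are equivalent. (i) The space $\mathcal{X}$ admits a Lebesgue decomposition relative to $\mathcal{W}$ that is compatible with that of $\mathcal{Y}$. (ii) For every $\psi\in\mathcal{X}^\perp=\{\psi\in\mathcal{Y}^*:\psi|_{\mathcal{X}}=0\}$, if we write $\psi=\psi_a+\psi_s$ with $\psi_a\in\mathrm{AC}_{\mathcal{W}}(\mathcal{Y})$ and $\psi_s\in\mathrm{SG}_{\mathcal{W}}(\mathcal{Y})$, then $\psi_a\in\mathcal{X}^\perp$ and $\psi_s\in\mathcal{X}^\perp$.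
   Context: For a subspace $\mathcal{X}\subset\mathcal{W}$, a bounded linear functional on $\mathcal{X}$ is absolutely continuous (relative to $\mathcal{W}$) if it extends to a weak-$*$ continuous linear functional on $\mathcal{W}$; $\mathrm{AC}_{\mathcal{W}}(\mathcal{X})\subset\mathcal{X}^*$ is the space of these functionals. $\mathcal{X}$ admits a Lebesgue decomposition relative to $\mathcal{W}$ if there is a bounded linear idempotent $L:\mathcal{X}^*\to\mathcal{X}^*$ with $L\mathcal{X}^*=\mathrm{AC}_{\mathcal{W}}(\mathcal{X})$ and $\|\phi\|=\|L\phi\|+\|(I-L)\phi\|$ for all $\phi\in\mathcal{X}^*$. Then $\mathrm{SG}_{\mathcal{W}}(\mathcal{X}):=(I-L)\mathcal{X}^*$ is uniquely determined. If $\mathcal{X}\subset\mathcal{Y}$ both admit Lebesgue decompositions, these are compatible if for every $\psi=\psi_a+\psi_s\in\mathcal{Y}^*$ with $\psi_a\in\mathrm{AC}_{\mathcal{W}}(\mathcal{Y})$, $\psi_s\in\mathrm{SG}_{\mathcal{W}}(\mathcal{Y})$, one has $\psi_a|_{\mathcal{X}}\in\mathrm{AC}_{\mathcal{W}}(\mathcal{X})$ and $\psi_s|_{\mathcal{X}}\in\mathrm{SG}_{\mathcal{W}}(\mathcal{X})$. *)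

theory Defs
  imports "HOL-Analysis.Analysis"
begin

(* Scalars: a commutative normed field that is a Euclidean space over the reals is, by Frobenius'
   theorem, the field of real or of complex numbers, and "real" and "complex" are both instances
   of the sort used here. All statements thus cover exactly the real and the complex case. *)

locale normed_space_over = vector_space smul
  for smul :: "'k::{real_normed_field, euclidean_space} \<Rightarrow> 'v::real_normed_vector \<Rightarrow> 'v" +
  assumes smul_of_real: "smul (of_real r) x = r *\<^sub>R x"
    and norm_smul: "norm (smul a x) = norm a * norm x"

lemma normed_space_over_real:
  "normed_space_over (scaleR :: real \<Rightarrow> 'v::real_normed_vector \<Rightarrow> 'v)"
  by unfold_locales (auto simp: algebra_simps)

lemma normed_space_over_mult:
  "normed_space_over ((*) :: 'k::{real_normed_field, euclidean_space} \<Rightarrow> 'k \<Rightarrow> 'k)"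
  by unfold_locales (auto simp: algebra_simps norm_mult scaleR_conv_of_real)

text \<open>Pointwise scalar multiplication on \<^typ>\<open>'v \<Rightarrow>\<^sub>L 'k\<close>.\<close>

definition smult_blinfun ::
  "'k::{real_normed_field, euclidean_space} \<Rightarrow> ('v::real_normed_vector \<Rightarrow>\<^sub>L 'k) \<Rightarrow> ('v \<Rightarrow>\<^sub>L 'k)"
  (infixr "\<odot>" 75)
  where "a \<odot> f = blinfun_mult_right a o\<^sub>L f"

lemma smult_blinfun_apply [simp]: "blinfun_apply (a \<odot> f) x = a * blinfun_apply f x"
  by (simp add: smult_blinfun_def)

lemma norm_smult_blinfun: "norm (a \<odot> f) = norm a * norm f"
proof (cases "a = 0")
  case True
  then have "a \<odot> f = 0" by (intro blinfun_eqI) simp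
  with True show ?thesis by simp
next
  case False
  have le: "norm (b \<odot> g) \<le> norm b * norm g" for b :: 'b and g :: "'a \<Rightarrow>\<^sub>L 'b"
    by (rule norm_blinfun_bound)
      (auto simp: norm_mult mult.assoc intro!: mult_left_mono norm_blinfun)
  have "norm a * norm f = norm a * norm (inverse a \<odot> (a \<odot> f))"
    using False by (intro arg_cong[where f = "\<lambda>g. norm a * norm g"] blinfun_eqI) simp
  also have "\<dots> \<le> norm a * (norm (inverse a) * norm (a \<odot> f))"
    by (intro mult_left_mono le) simp
  also have "\<dots> = norm (a \<odot> f)"
    using False by (simp add: norm_inverse)
  finally show ?thesis using le[of a f] by simp
qed

interpretation blinfun_over: normed_space_over smult_blinfun
  by unfold_locales
    (auto intro!: blinfun_eqI
      simp: norm_smult_blinfun blinfun.add_left blinfun.scaleR_left algebra_simps scaleR_conv_of_real)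

definition dual_space ::
  "('k::{real_normed_field, euclidean_space} \<Rightarrow> 'v::real_normed_vector \<Rightarrow> 'v) \<Rightarrow> ('v \<Rightarrow>\<^sub>L 'k) set"
  where "dual_space smul = {f. \<forall>a x. blinfun_apply f (smul a x) = a * blinfun_apply f x}"

text \<open>The library topology on functions is that of pointwise convergence, so this is the
  weak-star topology of \<^term>\<open>W\<close> when \<^term>\<open>W\<close> is a dual space.\<close>

definition weak_star_topology ::
  "('v::real_normed_vector \<Rightarrow>\<^sub>L 'k::{real_normed_field, euclidean_space}) set \<Rightarrow> ('v \<Rightarrow>\<^sub>L 'k) topology"
  where "weak_star_topology W = pullback_topology W blinfun_apply euclidean"

definition linear_functional_on ::
  "('v::real_normed_vector \<Rightarrow>\<^sub>L 'k::{real_normed_field, euclidean_space}) set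
    \<Rightarrow> (('v \<Rightarrow>\<^sub>L 'k) \<Rightarrow> 'k) \<Rightarrow> bool"
  where "linear_functional_on X \<phi> \<longleftrightarrow>
    (\<forall>x\<in>X. \<forall>y\<in>X. \<phi> (x + y) = \<phi> x + \<phi> y) \<and> (\<forall>a. \<forall>x\<in>X. \<phi> (a \<odot> x) = a * \<phi> x)"

text \<open>The dual of a subspace \<^term>\<open>X\<close> with the norm inherited from \<^typ>\<open>'v \<Rightarrow>\<^sub>L 'k\<close>.
  A functional on \<^term>\<open>X\<close> is represented by the total function that vanishes outside
  \<^term>\<open>X\<close>; this makes the representation unique and the vector space operations pointwise.\<close>

definition dual ::
  "('v::real_normed_vector \<Rightarrow>\<^sub>L 'k::{real_normed_field, euclidean_space}) set
    \<Rightarrow> (('v \<Rightarrow>\<^sub>L 'k) \<Rightarrow> 'k) set"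
  where "dual X = {\<phi>. linear_functional_on X \<phi> \<and> (\<exists>C. \<forall>x\<in>X. norm (\<phi> x) \<le> C * norm x)
    \<and> (\<forall>x. x \<notin> X \<longrightarrow> \<phi> x = 0)}"

definition dual_norm ::
  "('v::real_normed_vector \<Rightarrow>\<^sub>L 'k::{real_normed_field, euclidean_space}) set
    \<Rightarrow> (('v \<Rightarrow>\<^sub>L 'k) \<Rightarrow> 'k) \<Rightarrow> real"
  where "dual_norm X \<phi> = (SUP x\<in>{x\<in>X. norm x \<le> 1}. norm (\<phi> x))"

definition restrict0 :: "'a set \<Rightarrow> ('a \<Rightarrow> 'b::zero) \<Rightarrow> 'a \<Rightarrow> 'b"
  where "restrict0 X \<psi> = (\<lambda>x. if x \<in> X then \<psi> x else 0)"

definition AC ::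
  "('v::real_normed_vector \<Rightarrow>\<^sub>L 'k::{real_normed_field, euclidean_space}) set
    \<Rightarrow> ('v \<Rightarrow>\<^sub>L 'k) set \<Rightarrow> (('v \<Rightarrow>\<^sub>L 'k) \<Rightarrow> 'k) set"
  where "AC W X = {\<phi> \<in> dual X. \<exists>\<Phi>. linear_functional_on W \<Phi>
    \<and> continuous_map (weak_star_topology W) euclidean \<Phi> \<and> (\<forall>x\<in>X. \<Phi> x = \<phi> x)}"

definition is_Lebesgue_projection ::
  "('v::real_normed_vector \<Rightarrow>\<^sub>L 'k::{real_normed_field, euclidean_space}) set
    \<Rightarrow> ('v \<Rightarrow>\<^sub>L 'k) set \<Rightarrow> ((('v \<Rightarrow>\<^sub>L 'k) \<Rightarrow> 'k) \<Rightarrow> (('v \<Rightarrow>\<^sub>L 'k) \<Rightarrow> 'k)) \<Rightarrow> bool"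
  where "is_Lebesgue_projection W X L \<longleftrightarrow>
    L ` dual X = AC W X
    \<and> (\<forall>\<phi>\<in>dual X. \<forall>\<psi>\<in>dual X. L (\<lambda>x. \<phi> x + \<psi> x) = (\<lambda>x. L \<phi> x + L \<psi> x))
    \<and> (\<forall>a. \<forall>\<phi>\<in>dual X. L (\<lambda>x. a * \<phi> x) = (\<lambda>x. a * L \<phi> x))
    \<and> (\<exists>C. \<forall>\<phi>\<in>dual X. dual_norm X (L \<phi>) \<le> C * dual_norm X \<phi>)
    \<and> (\<forall>\<phi>\<in>dual X. L (L \<phi>) = L \<phi>)
    \<and> (\<forall>\<phi>\<in>dual X. dual_norm X \<phi> = dual_norm X (L \<phi>) + dual_norm X (\<lambda>x. \<phi> x - L \<phi> x))"

definition admits_Lebesgue_decomposition ::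
  "('v::real_normed_vector \<Rightarrow>\<^sub>L 'k::{real_normed_field, euclidean_space}) set
    \<Rightarrow> ('v \<Rightarrow>\<^sub>L 'k) set \<Rightarrow> bool"
  where "admits_Lebesgue_decomposition W X \<longleftrightarrow> (\<exists>L. is_Lebesgue_projection W X L)"

definition SG ::
  "('v::real_normed_vector \<Rightarrow>\<^sub>L 'k::{real_normed_field, euclidean_space}) set
    \<Rightarrow> ('v \<Rightarrow>\<^sub>L 'k) set \<Rightarrow> (('v \<Rightarrow>\<^sub>L 'k) \<Rightarrow> 'k) set"
  where "SG W X = (THE S. \<exists>L. is_Lebesgue_projection W X L \<and> S = (\<lambda>\<phi>. (\<lambda>x. \<phi> x - L \<phi> x)) ` dual X)"

definition compatible ::
  "('v::real_normed_vector \<Rightarrow>\<^sub>L 'k::{real_normed_field, euclidean_space}) set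
    \<Rightarrow> ('v \<Rightarrow>\<^sub>L 'k) set \<Rightarrow> ('v \<Rightarrow>\<^sub>L 'k) set \<Rightarrow> bool"
  where "compatible W X Y \<longleftrightarrow>
    (\<forall>\<psi>\<in>dual Y. \<forall>\<psi>\<^sub>a\<in>AC W Y. \<forall>\<psi>\<^sub>s\<in>SG W Y. \<psi> = (\<lambda>y. \<psi>\<^sub>a y + \<psi>\<^sub>s y) \<longrightarrow>
      restrict0 X \<psi>\<^sub>a \<in> AC W X \<and> restrict0 X \<psi>\<^sub>s \<in> SG W X)"

definition annihilator ::
  "('v::real_normed_vector \<Rightarrow>\<^sub>L 'k::{real_normed_field, euclidean_space}) set
    \<Rightarrow> ('v \<Rightarrow>\<^sub>L 'k) set \<Rightarrow> (('v \<Rightarrow>\<^sub>L 'k) \<Rightarrow> 'k) set"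
  where "annihilator Y X = {\<psi> \<in> dual Y. \<forall>x\<in>X. \<psi> x = 0}"

text \<open>The description in the definition of \<^const>\<open>SG\<close> is proper: the singular part does not
  depend on the choice of the projection.\<close>

lemma dual_add:
  assumes "\<phi> \<in> dual X" "\<psi> \<in> dual X"
  shows "(\<lambda>x. \<phi> x + \<psi> x) \<in> dual X"
proof -
  obtain C D where "\<forall>x\<in>X. norm (\<phi> x) \<le> C * norm x" "\<forall>x\<in>X. norm (\<psi> x) \<le> D * norm x"
    using assms by (auto simp: dual_def)
  then have "\<exists>C. \<forall>x\<in>X. norm (\<phi> x + \<psi> x) \<le> C * norm x"
    by (auto simp: distrib_right intro!: exI[of _ "C + D"] norm_triangle_mono)
  moreover have "linear_functional_on X (\<lambda>x. \<phi> x + \<psi> x)"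
    using assms by (auto simp: dual_def linear_functional_on_def algebra_simps)
  ultimately show ?thesis
    using assms unfolding dual_def by auto
qed

lemma dual_scale:
  assumes "\<phi> \<in> dual X"
  shows "(\<lambda>x. a * \<phi> x) \<in> dual X"
proof -
  obtain C where "\<forall>x\<in>X. norm (\<phi> x) \<le> C * norm x"
    using assms by (auto simp: dual_def)
  then have "\<exists>C. \<forall>x\<in>X. norm (a * \<phi> x) \<le> C * norm x"
    by (auto simp: norm_mult mult.assoc intro!: exI[of _ "norm a * C"] mult_left_mono)
  moreover have "linear_functional_on X (\<lambda>x. a * \<phi> x)"
    using assms by (auto simp: dual_def linear_functional_on_def algebra_simps)
  ultimately show ?thesis
    using assms unfolding dual_def by auto
qed

lemma dual_diff:
  assumes "\<phi> \<in> dual X" "\<psi> \<in> dual X"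
  shows "(\<lambda>x. \<phi> x - \<psi> x) \<in> dual X"
  using dual_add[OF assms(1) dual_scale[OF assms(2), of "-1"]] by simp

lemma dual_norm_ge:
  assumes "\<phi> \<in> dual X" "x \<in> X" "norm x \<le> 1"
  shows "norm (\<phi> x) \<le> dual_norm X \<phi>"
proof -
  obtain C where C: "\<forall>x\<in>X. norm (\<phi> x) \<le> C * norm x"
    using assms by (auto simp: dual_def)
  have "norm (\<phi> y) \<le> \<bar>C\<bar>" if "y \<in> X" "norm y \<le> 1" for y
  proof -
    have "norm (\<phi> y) \<le> C * norm y" using C that by simp
    also have "\<dots> \<le> \<bar>C\<bar> * 1" using that by (intro mult_mono) auto
    finally show ?thesis by simp
  qed
  then show ?thesis
    unfolding dual_norm_def using assms by (intro cSUP_upper bdd_aboveI2[where M = "\<bar>C\<bar>"]) auto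
qed

lemma dual_norm_le_0:
  assumes X: "blinfun_over.subspace X" and \<phi>: "\<phi> \<in> dual X" and le: "dual_norm X \<phi> \<le> 0"
  shows "\<phi> = (\<lambda>x. 0)"
proof
  fix x
  show "\<phi> x = 0"
  proof (cases "x \<in> X \<and> x \<noteq> 0")
    case True
    define y where "y = of_real (inverse (norm x)) \<odot> x"
    have "y \<in> X" using True X by (auto simp: y_def blinfun_over.subspace_scale)
    moreover have "norm y \<le> 1"
      using True by (simp add: y_def norm_smult_blinfun norm_inverse)
    ultimately have "\<phi> y = 0" using dual_norm_ge[OF \<phi>, of y] le
      by (metis norm_le_zero_iff order_trans)
    moreover have "\<phi> y = of_real (inverse (norm x)) * \<phi> x"
      using \<phi> True by (simp add: dual_def linear_functional_on_def y_def)
    ultimately show ?thesis using True by simp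
  next
    case False
    have "\<phi> 0 = 0"
    proof -
      have "0 \<in> X" using X by (rule blinfun_over.subspace_0)
      then have "\<phi> (0 + 0) = \<phi> 0 + \<phi> 0"
        using \<phi> unfolding dual_def linear_functional_on_def by blast
      then show ?thesis by simp
    qed
    with False \<phi> show ?thesis by (auto simp: dual_def)
  qed
qed

lemma Lebesgue_projection_diff:
  assumes L: "is_Lebesgue_projection W X L" and "\<psi> \<in> dual X" "\<zeta> \<in> dual X"
  shows "L (\<lambda>x. \<psi> x - \<zeta> x) = (\<lambda>x. L \<psi> x - L \<zeta> x)"
proof -
  have add: "\<forall>\<phi>\<in>dual X. \<forall>\<psi>\<in>dual X. L (\<lambda>x. \<phi> x + \<psi> x) = (\<lambda>x. L \<phi> x + L \<psi> x)"
    and scale: "\<forall>a. \<forall>\<phi>\<in>dual X. L (\<lambda>x. a * \<phi> x) = (\<lambda>x. a * L \<phi> x)"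
    using L unfolding is_Lebesgue_projection_def by - (elim conjE, assumption)+
  show ?thesis
    using add[rule_format, OF assms(2) dual_scale[OF assms(3), of "-1"]]
      scale[rule_format, OF assms(3), of "-1"] by simp
qed

lemma Lebesgue_projection_facts:
  assumes L: "is_Lebesgue_projection W X L" and \<phi>: "\<phi> \<in> dual X"
  shows "L \<phi> \<in> AC W X" and "L \<phi> \<in> dual X" and "L (L \<phi>) = L \<phi>"
    and "dual_norm X \<phi> = dual_norm X (L \<phi>) + dual_norm X (\<lambda>x. \<phi> x - L \<phi> x)"
    and "\<phi> \<in> AC W X \<Longrightarrow> L \<phi> = \<phi>"
proof -
  have img: "L ` dual X = AC W X" and idem: "\<forall>\<phi>\<in>dual X. L (L \<phi>) = L \<phi>"
    and nrm: "\<forall>\<phi>\<in>dual X. dual_norm X \<phi> = dual_norm X (L \<phi>) + dual_norm X (\<lambda>x. \<phi> x - L \<phi> x)"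
    using L unfolding is_Lebesgue_projection_def by - (elim conjE, assumption)+
  show AC: "L \<phi> \<in> AC W X" using img \<phi> by auto
  then show "L \<phi> \<in> dual X" by (simp add: AC_def)
  show "L (L \<phi>) = L \<phi>" using idem \<phi> by simp
  show "dual_norm X \<phi> = dual_norm X (L \<phi>) + dual_norm X (\<lambda>x. \<phi> x - L \<phi> x)"
    using nrm \<phi> by (rule bspec)
  show "L \<phi> = \<phi>" if "\<phi> \<in> AC W X"
    using that idem unfolding img[symmetric] by auto
qed

lemma Lebesgue_projection_unique:
  assumes X: "blinfun_over.subspace X"
    and P: "is_Lebesgue_projection W X P" and Q: "is_Lebesgue_projection W X Q" and \<phi>: "\<phi> \<in> dual X"
  shows "P \<phi> = Q \<phi>"
proof -
  note Pf = Lebesgue_projection_facts[OF P] and Qf = Lebesgue_projection_facts[OF Q]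
  note Pdiff = Lebesgue_projection_diff[OF P] and Qdiff = Lebesgue_projection_diff[OF Q]
  note PAC = Pf(5) and QAC = Qf(5)
  define \<eta> where "\<eta> = (\<lambda>x. \<phi> x - P \<phi> x)"
  have \<eta>: "\<eta> \<in> dual X" unfolding \<eta>_def by (intro dual_diff Pf(2) \<phi>)
  have P\<eta>: "P \<eta> = (\<lambda>x. 0)"
    unfolding \<eta>_def Pdiff[OF \<phi> Pf(2)[OF \<phi>]] Pf(3)[OF \<phi>] by simp
  have neg: "dual_norm X (\<lambda>x. - \<psi> x) = dual_norm X \<psi>" for \<psi> by (simp add: dual_norm_def)
  define \<theta> where "\<theta> = (\<lambda>x. \<eta> x - Q \<eta> x)"
  have \<theta>: "\<theta> \<in> dual X" unfolding \<theta>_def by (intro dual_diff Qf(2) \<eta>)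
  have P\<theta>: "P \<theta> = (\<lambda>x. - Q \<eta> x)"
    unfolding \<theta>_def Pdiff[OF \<eta> Qf(2)[OF \<eta>]] P\<eta> PAC[OF Qf(2,1)[OF \<eta>]] by simp
  have "(\<lambda>x. \<theta> x - P \<theta> x) = \<eta>" unfolding P\<theta> by (simp add: \<theta>_def)
  then have "dual_norm X \<theta> = dual_norm X (Q \<eta>) + dual_norm X \<eta>"
    using Pf(4)[OF \<theta>] by (simp add: P\<theta> neg)
  moreover have "dual_norm X \<eta> = dual_norm X (Q \<eta>) + dual_norm X \<theta>"
    unfolding \<theta>_def by (rule Qf(4)[OF \<eta>])
  ultimately have "dual_norm X (Q \<eta>) \<le> 0" by simp
  then have "Q \<eta> = (\<lambda>x. 0)" by (rule dual_norm_le_0[OF X Qf(2)[OF \<eta>]])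
  moreover have "Q \<eta> = (\<lambda>x. Q \<phi> x - P \<phi> x)"
    unfolding \<eta>_def Qdiff[OF \<phi> Pf(2)[OF \<phi>]] QAC[OF Pf(2,1)[OF \<phi>]] ..
  ultimately show ?thesis by (auto simp: fun_eq_iff)
qed

lemma SG_eq:
  assumes "blinfun_over.subspace X" "is_Lebesgue_projection W X L"
  shows "SG W X = (\<lambda>\<phi>. (\<lambda>x. \<phi> x - L \<phi> x)) ` dual X"
  unfolding SG_def
proof (rule the_equality)
  fix S
  assume "\<exists>L. is_Lebesgue_projection W X L \<and> S = (\<lambda>\<phi>. (\<lambda>x. \<phi> x - L \<phi> x)) ` dual X"
  then obtain L' where L': "is_Lebesgue_projection W X L'"
    and S: "S = (\<lambda>\<phi>. (\<lambda>x. \<phi> x - L' \<phi> x)) ` dual X" by blast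
  show "S = (\<lambda>\<phi>. (\<lambda>x. \<phi> x - L \<phi> x)) ` dual X"
    unfolding S using Lebesgue_projection_unique[OF assms(1) L' assms(2)] by (intro image_cong) auto
qed (use assms(2) in blast)

end

theory Submission
  imports Defs
begin

text \<open>
  Let \<open>L\<close> be the Lebesgue projection of \<open>Y\<close>. Since \<open>\<psi> = L \<psi> + (\<psi> - L \<psi>)\<close> is the only splitting
  into an absolutely continuous and a singular part, condition (ii) says that \<open>L\<close> maps the
  annihilator of \<open>X\<close> into itself (\<open>annihilator_invariant_iff\<close>).

  If (i) holds and \<open>\<psi>\<close> vanishes on \<open>X\<close>, then by compatibility the restrictions of \<open>L \<psi>\<close> and
  \<open>\<psi> - L \<psi>\<close> to \<open>X\<close> are the absolutely continuous and the singular part of the zero functional, so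
  both vanish (\<open>compatible_imp_annihilator_invariant\<close>).

  Conversely, the dual of \<open>X\<close> is the quotient of the dual of \<open>Y\<close> by the annihilator of \<open>X\<close>, because
  every functional on \<open>X\<close> extends to \<open>Y\<close>. Invariance of the annihilator therefore lets \<open>L\<close> descend
  to a map \<open>K\<close> on the dual of \<open>X\<close> (\<open>induced_Lebesgue_projection\<close>): extend \<open>\<phi>\<close> to \<open>Y\<close>, apply \<open>L\<close>,
  restrict to \<open>X\<close>. The range of \<open>K\<close> is the space of absolutely continuous functionals because these
  extend to absolutely continuous functionals on \<open>Y\<close>, which \<open>L\<close> fixes. Choosing the extension
  \<open>\<psi>\<close> of \<open>\<phi>\<close> with the same norm gives the norm identity:
  \<open>\<parallel>\<phi>\<parallel> \<le> \<parallel>K \<phi>\<parallel> + \<parallel>\<phi> - K \<phi>\<parallel> \<le> \<parallel>L \<psi>\<parallel> + \<parallel>\<psi> - L \<psi>\<parallel> = \<parallel>\<psi>\<parallel> = \<parallel>\<phi>\<parallel>\<close>.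
  Compatibility holds because \<open>K\<close> commutes with restriction.

  Two analytic facts enter. One is the norm-preserving Hahn--Banach theorem over the scalar field
  \<open>'k\<close> (\<open>Hahn_Banach_dual\<close>), deduced from the real theorem. The other is that weak-star continuous
  functionals on \<open>W\<close> are bounded (\<open>weak_star_continuous_imp_bounded\<close>), so that their restrictions to
  \<open>Y\<close> do belong to the dual of \<open>Y\<close>.
\<close>

section \<open>The Hahn--Banach theorem over the scalar field\<close>

text \<open>
  Zorn's lemma is applied to graphs: subspaces of \<open>'b \<times> real\<close> that lie below \<open>p\<close>. Such a subspace is
  automatically single-valued, since \<open>(0, r)\<close> and \<open>(0, -r)\<close> force \<open>r \<le> p 0 = 0\<close> and \<open>- r \<le> 0\<close>, so
  neither domains nor functions need to be tracked along chains.
\<close>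

lemma Hahn_Banach_sublinear:
  fixes p :: "'b::real_vector \<Rightarrow> real" and S :: "'b set"
  assumes S: "subspace S"
    and padd: "\<And>x y. p (x + y) \<le> p x + p y"
    and pscale: "\<And>r x. 0 < r \<Longrightarrow> p (r *\<^sub>R x) = r * p x"
    and fadd: "\<And>x y. x \<in> S \<Longrightarrow> y \<in> S \<Longrightarrow> f (x + y) = f x + f y"
    and fscale: "\<And>r x. x \<in> S \<Longrightarrow> f (r *\<^sub>R x) = r * f x"
    and fle: "\<And>x. x \<in> S \<Longrightarrow> f x \<le> p x"
  obtains g where "linear g" "\<And>x. x \<in> S \<Longrightarrow> g x = f x" "\<And>x. g x \<le> p x"
proof -
  define F where "F = (\<lambda>x. (x, f x)) ` S"
  define \<A> where "\<A> = {G. subspace G \<and> F \<subseteq> G \<and> (\<forall>(x, r)\<in>G. r \<le> p x)}"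
  have p0: "p 0 = 0"
    using pscale[of 2 0] by simp
  have f0: "f 0 = 0"
    using fscale[of 0 0] subspace_0[OF S] by simp
  have "subspace F"
    unfolding subspace_def
  proof (intro conjI ballI allI)
    show "0 \<in> F"
      using imageI[OF subspace_0[OF S], of "\<lambda>x. (x, f x)"] f0 by (simp add: F_def zero_prod_def)
  next
    fix u v assume "u \<in> F" "v \<in> F"
    then obtain x y where "u = (x, f x)" "x \<in> S" "v = (y, f y)" "y \<in> S"
      by (auto simp: F_def)
    then have "u + v = (x + y, f (x + y))" "x + y \<in> S"
      using subspace_add[OF S] by (auto simp: fadd)
    then show "u + v \<in> F" unfolding F_def by (rule image_eqI)
  next
    fix c u assume "u \<in> F"
    then obtain x where "u = (x, f x)" "x \<in> S"
      by (auto simp: F_def)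
    then have "c *\<^sub>R u = (c *\<^sub>R x, f (c *\<^sub>R x))" "c *\<^sub>R x \<in> S"
      using subspace_scale[OF S] by (auto simp: fscale scaleR_prod_def)
    then show "c *\<^sub>R u \<in> F" unfolding F_def by (rule image_eqI)
  qed
  then have F: "F \<in> \<A>"
    using fle by (auto simp: \<A>_def F_def)
  have "\<exists>M\<in>\<A>. \<forall>G\<in>\<A>. M \<subseteq> G \<longrightarrow> G = M"
  proof (rule subset_Zorn_nonempty)
    show "\<A> \<noteq> {}" using F by blast
  next
    fix \<C> assume ne: "\<C> \<noteq> {}" and C: "subset.chain \<A> \<C>"
    have CA: "\<C> \<subseteq> \<A>" using C by (simp add: subset_chain_def)
    obtain G where G: "G \<in> \<C>" using ne by blast
    have "subspace (\<Union>\<C>)"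
      unfolding subspace_def
    proof (intro conjI ballI allI)
      show "0 \<in> \<Union>\<C>"
        using G CA by (auto simp: \<A>_def intro: subspace_0)
    next
      fix u v assume "u \<in> \<Union>\<C>" "v \<in> \<Union>\<C>"
      then obtain H K where HK: "u \<in> H" "v \<in> K" "H \<in> \<C>" "K \<in> \<C>" by blast
      then have "H \<subseteq> K \<or> K \<subseteq> H" using C by (auto simp: subset_chain_def)
      then obtain M where "M \<in> \<C>" "u \<in> M" "v \<in> M" using HK by blast
      then show "u + v \<in> \<Union>\<C>"
        using CA by (auto simp: \<A>_def intro: subspace_add)
    next
      fix c u assume "u \<in> \<Union>\<C>"
      then show "c *\<^sub>R u \<in> \<Union>\<C>"
        using CA by (auto simp: \<A>_def intro: subspace_scale)
    qed
    moreover have "F \<subseteq> \<Union>\<C>" using G CA by (auto simp: \<A>_def)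
    moreover have "\<forall>(x, r)\<in>\<Union>\<C>. r \<le> p x" using CA by (fastforce simp: \<A>_def)
    ultimately show "\<Union>\<C> \<in> \<A>" by (simp add: \<A>_def)
  qed
  then obtain M where M: "M \<in> \<A>" and max: "\<And>G. G \<in> \<A> \<Longrightarrow> M \<subseteq> G \<Longrightarrow> G = M"
    by blast
  have subM: "subspace M" and FM: "F \<subseteq> M" and Mle: "\<And>x r. (x, r) \<in> M \<Longrightarrow> r \<le> p x"
    using M by (auto simp: \<A>_def)
  have uniq: "r = s" if "(x, r) \<in> M" "(x, s) \<in> M" for x r s
    using Mle[of 0 "r - s"] Mle[of 0 "s - r"] subspace_diff[OF subM that]
      subspace_diff[OF subM that(2,1)] p0 by simp
  have ex: "\<exists>r. (x0, r) \<in> M" for x0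
  proof -
    \<comment> \<open>Adjoining \<open>(x0, r0)\<close> to \<open>M\<close> keeps it below \<open>p\<close> iff \<open>r - p (x - x0) \<le> r0 \<le> p (y + x0) - s\<close> for all
      \<open>(x, r)\<close> and \<open>(y, s)\<close> in \<open>M\<close>: by homogeneity only the multiples \<open>1\<close> and \<open>-1\<close> of the new vector matter.\<close>
    define r0 where "r0 = (SUP (x, r)\<in>M. r - p (x - x0))"
    have ne: "M \<noteq> {}" using subspace_0[OF subM] by blast
    have cross: "r - p (x - x0) \<le> p (y + x0) - s" if "(x, r) \<in> M" "(y, s) \<in> M" for x r y s
    proof -
      have "r + s \<le> p (x + y)" using Mle[of "x + y" "r + s"] subspace_add[OF subM that] by simp
      also have "\<dots> \<le> p (x - x0) + p (y + x0)" using padd[of "x - x0" "y + x0"] by simp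
      finally show ?thesis by simp
    qed
    have lower: "r - p (x - x0) \<le> r0" if "(x, r) \<in> M" for x r
    proof -
      have "bdd_above ((\<lambda>(x, r). r - p (x - x0)) ` M)"
        using cross[OF _ that] by (intro bdd_aboveI[where M = "p (x + x0) - r"]) auto
      from cSUP_upper[OF that this] show ?thesis by (simp add: r0_def)
    qed
    have upper: "r0 \<le> p (y + x0) - s" if "(y, s) \<in> M" for y s
      unfolding r0_def using cross[OF _ that] by (intro cSUP_least ne) auto
    define G where "G = {u + v | u v. u \<in> M \<and> v \<in> span {(x0, r0)}}"
    have "r + t * r0 \<le> p (x + t *\<^sub>R x0)" if xr: "(x, r) \<in> M" for x r t
    proof -
      consider "t = 0" | "t > 0" | "t < 0" by linarith
      then show ?thesis
      proof cases
        case 1 then show ?thesis using Mle[OF xr] by simp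
      next
        case 2
        have "(x /\<^sub>R t, r / t) \<in> M"
          using subspace_scale[OF subM xr, of "inverse t"] by (simp add: divide_inverse_commute)
        from upper[OF this] have "t * (r / t + r0) \<le> t * p (x /\<^sub>R t + x0)"
          using 2 by (intro mult_left_mono) auto
        also have "\<dots> = p (x + t *\<^sub>R x0)"
          using 2 by (subst pscale[symmetric]) (auto simp: algebra_simps)
        finally show ?thesis using 2 by (simp add: algebra_simps)
      next
        case 3
        define q where "q = - t"
        have q: "q > 0" using 3 by (simp add: q_def)
        have "(x /\<^sub>R q, r / q) \<in> M"
          using subspace_scale[OF subM xr, of "inverse q"] by (simp add: divide_inverse_commute)
        from lower[OF this] have "q * (r / q - r0) \<le> q * p (x /\<^sub>R q - x0)"
          using q by (intro mult_left_mono) auto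
        also have "\<dots> = p (x - q *\<^sub>R x0)"
          using q by (subst pscale[symmetric]) (auto simp: algebra_simps)
        finally show ?thesis using q by (simp add: algebra_simps q_def)
      qed
    qed
    then have le: "\<forall>(x, r)\<in>G. r \<le> p x" by (auto simp: G_def span_singleton)
    have "subspace G"
      unfolding G_def by (rule subspace_sums[OF subM subspace_span])
    moreover have MG: "M \<subseteq> G"
    proof
      fix u assume "u \<in> M"
      then have "u = u + 0 \<and> u \<in> M" by simp
      then show "u \<in> G" unfolding G_def using span_zero by blast
    qed
    ultimately have "G \<in> \<A>" using le FM by (auto simp: \<A>_def)
    then have "G = M" using MG by (rule max)
    moreover have "(x0, r0) \<in> G"
    proof -
      have "(x0, r0) = 0 + (x0, r0) \<and> 0 \<in> M" using subspace_0[OF subM] by simp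
      then show ?thesis unfolding G_def using span_base[of "(x0, r0)"] by blast
    qed
    ultimately show ?thesis by blast
  qed
  define g where "g = (\<lambda>x. THE r. (x, r) \<in> M)"
  have gM: "(x, g x) \<in> M" for x
    unfolding g_def using ex[of x] uniq by (metis theI)
  show ?thesis
  proof
    show "linear g"
      using uniq[OF gM] subspace_add[OF subM gM gM] subspace_scale[OF subM gM]
      by (intro linearI) auto
    show "g x = f x" if "x \<in> S" for x
      using uniq[OF gM] FM that by (auto simp: F_def)
    show "g x \<le> p x" for x using Mle[OF gM] .
  qed
qed

text \<open>
  The norm of \<open>'k\<close> is both multiplicative and Euclidean. Hence multiplication by \<open>c\<close> scales all norms
  by \<open>norm c\<close>, and by polarization it scales inner products by the square of this factor.
\<close>

lemma inner_mult_right_similarity: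
  fixes a b c :: "'k::{real_normed_field, euclidean_space}"
  shows "(a * c) \<bullet> (b * c) = (norm c)\<^sup>2 * (a \<bullet> b)"
proof -
  have "norm (a * c + b * c) = norm (a + b) * norm c"
    by (simp add: norm_mult flip: distrib_right)
  then show ?thesis
    by (simp add: dot_norm norm_mult power_mult_distrib algebra_simps diff_divide_distrib)
qed

text \<open>
  The real functional \<open>a \<mapsto> a \<bullet> 1\<close> plays the part of the real part on \<open>'k\<close>, and
  \<open>(norm c)\<^sup>2 *\<^sub>R inverse c\<close> that of the conjugate of \<open>c\<close>. This and the next lemma say that
  \<open>(a, b) \<mapsto> (a * b) \<bullet> 1\<close> is a perfect pairing. It is what allows a \<open>'k\<close>-linear functional to be
  recovered from its real part without knowing which field \<open>'k\<close> is.
\<close>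

lemma real_functional_is_inner_mult_one:
  fixes h :: "'k::{real_normed_field, euclidean_space} \<Rightarrow> real"
  assumes "linear h"
  shows "\<exists>b. \<forall>a. h a = (a * b) \<bullet> 1"
proof -
  define c where "c = (\<Sum>i\<in>Basis. h i *\<^sub>R i)"
  have h: "h a = a \<bullet> c" for a
  proof -
    have "h a = h (\<Sum>i\<in>Basis. (a \<bullet> i) *\<^sub>R i)" by (simp add: euclidean_representation)
    also have "\<dots> = a \<bullet> c"
      by (simp add: c_def inner_sum_right linear_sum[OF assms] linear_cmul[OF assms] mult.commute)
    finally show ?thesis .
  qed
  show ?thesis
  proof (cases "c = 0")
    case True
    then show ?thesis using h by (intro exI[of _ 0]) simp
  next
    case False
    have "h a = (a * ((norm c)\<^sup>2 *\<^sub>R inverse c)) \<bullet> 1" for a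
      using inner_mult_right_similarity[of "a * inverse c" c 1] False h[of a]
      by (simp add: mult.assoc)
    then show ?thesis by blast
  qed
qed

lemma inner_mult_one_cancel:
  fixes b d :: "'k::{real_normed_field, euclidean_space}"
  assumes "\<And>a. (a * b) \<bullet> 1 = (a * d) \<bullet> 1"
  shows "b = d"
proof (rule ccontr)
  assume "b \<noteq> d"
  then have "(inverse (b - d) * (b - d)) \<bullet> 1 = (1 :: real)"
    by (simp add: dot_square_norm)
  then show False using assms[of "inverse (b - d)"] by (simp add: right_diff_distrib inner_diff_left)
qed

lemma smult_blinfun_of_real: "of_real r \<odot> x = r *\<^sub>R x"
  by (rule blinfun_over.smul_of_real)

lemma real_subspace:
  assumes "blinfun_over.subspace X"
  shows "subspace X"
  unfolding subspace_def
  using blinfun_over.subspace_0[OF assms] blinfun_over.subspace_add[OF assms]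
    blinfun_over.subspace_scale[OF assms] by (auto simp flip: smult_blinfun_of_real)

lemma dual_norm_apply:
  assumes X: "blinfun_over.subspace X" and \<phi>: "\<phi> \<in> dual X" and x: "x \<in> X"
  shows "norm (\<phi> x) \<le> dual_norm X \<phi> * norm x"
proof (cases "x = 0")
  case True
  obtain C where "\<forall>x\<in>X. norm (\<phi> x) \<le> C * norm x"
    using \<phi> by (auto simp: dual_def)
  then show ?thesis using True x by fastforce
next
  case False
  define y where "y = of_real (inverse (norm x)) \<odot> x"
  have "y \<in> X" using x X by (auto simp: y_def blinfun_over.subspace_scale)
  moreover have "norm y \<le> 1"
    using False by (simp add: y_def norm_smult_blinfun norm_inverse)
  ultimately have "norm (\<phi> y) \<le> dual_norm X \<phi>" by (rule dual_norm_ge[OF \<phi>])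
  moreover have "\<phi> y = of_real (inverse (norm x)) * \<phi> x"
    using \<phi> x by (simp add: dual_def linear_functional_on_def y_def)
  ultimately show ?thesis using False by (simp add: norm_mult norm_inverse norm_divide field_simps)
qed

lemma dual_norm_least:
  assumes "blinfun_over.subspace X" and "\<And>x. x \<in> X \<Longrightarrow> norm x \<le> 1 \<Longrightarrow> norm (\<phi> x) \<le> C"
  shows "dual_norm X \<phi> \<le> C"
  unfolding dual_norm_def using assms blinfun_over.subspace_0[OF assms(1)]
  by (intro cSUP_least) auto

lemma dual_norm_nonneg:
  assumes "blinfun_over.subspace X" "\<phi> \<in> dual X"
  shows "0 \<le> dual_norm X \<phi>"
  using dual_norm_ge[OF assms(2) blinfun_over.subspace_0[OF assms(1)]]
  by (auto intro: order_trans[OF norm_ge_zero])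

lemma dual_norm_add:
  assumes X: "blinfun_over.subspace X" and "\<phi> \<in> dual X" "\<psi> \<in> dual X"
  shows "dual_norm X (\<lambda>x. \<phi> x + \<psi> x) \<le> dual_norm X \<phi> + dual_norm X \<psi>"
  using assms by (intro dual_norm_least X norm_triangle_mono dual_norm_ge)

lemma restrict0_in_dual:
  assumes X: "blinfun_over.subspace X" and XY: "X \<subseteq> Y" and lin: "linear_functional_on Y \<Phi>"
    and bound: "\<exists>C. \<forall>y\<in>Y. norm (\<Phi> y) \<le> C * norm y"
  shows "restrict0 X \<Phi> \<in> dual X"
proof -
  obtain C where "\<forall>y\<in>Y. norm (\<Phi> y) \<le> C * norm y" using bound by blast
  then have "\<forall>x\<in>X. norm (restrict0 X \<Phi> x) \<le> C * norm x"
    using XY by (auto simp: restrict0_def)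
  moreover have "linear_functional_on X (restrict0 X \<Phi>)"
    using lin XY blinfun_over.subspace_add[OF X] blinfun_over.subspace_scale[OF X]
    by (simp add: linear_functional_on_def restrict0_def subset_iff)
  ultimately show ?thesis
    by (auto simp: dual_def restrict0_def)
qed

lemma restrict0_dual:
  assumes "X \<subseteq> Y" "blinfun_over.subspace X" "\<psi> \<in> dual Y"
  shows "restrict0 X \<psi> \<in> dual X"
  using assms by (intro restrict0_in_dual[of X Y]) (auto simp: dual_def)

lemma dual_norm_restrict0_le:
  assumes "X \<subseteq> Y" "blinfun_over.subspace X" "\<psi> \<in> dual Y"
  shows "dual_norm X (restrict0 X \<psi>) \<le> dual_norm Y \<psi>"
  using assms dual_norm_ge[OF assms(3)] by (intro dual_norm_least) (auto simp: restrict0_def)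

lemma restrict0_id:
  assumes "\<phi> \<in> dual X" "\<And>x. x \<in> X \<Longrightarrow> \<psi> x = \<phi> x"
  shows "restrict0 X \<psi> = \<phi>"
  using assms by (auto simp: restrict0_def dual_def)

text \<open>
  The real part \<open>x \<mapsto> \<phi> x \<bullet> 1\<close> extends to a real functional \<open>g\<close> with the same bound. The perfect
  pairing then produces a unique \<open>\<Psi> x\<close> with \<open>g (a \<odot> x) = (a * \<Psi> x) \<bullet> 1\<close> for all \<open>a\<close>; uniqueness makes
  \<open>\<Psi>\<close> linear over \<open>'k\<close> and an extension of \<open>\<phi>\<close>. For \<open>'k = complex\<close> this is the formula
  \<open>\<Psi> x = g x - \<i> g (\<i> x)\<close>.
\<close>

lemma Hahn_Banach_dual:
  fixes X Y :: "('v::real_normed_vector \<Rightarrow>\<^sub>L 'k::{real_normed_field, euclidean_space}) set"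
  assumes X: "blinfun_over.subspace X" and Y: "blinfun_over.subspace Y" and XY: "X \<subseteq> Y"
    and \<phi>: "\<phi> \<in> dual X"
  shows "\<exists>\<psi>\<in>dual Y. restrict0 X \<psi> = \<phi> \<and> dual_norm Y \<psi> = dual_norm X \<phi>"
proof -
  define C where "C = dual_norm X \<phi>"
  have C0: "0 \<le> C" unfolding C_def by (rule dual_norm_nonneg[OF X \<phi>])
  have lin: "\<And>x y. x \<in> X \<Longrightarrow> y \<in> X \<Longrightarrow> \<phi> (x + y) = \<phi> x + \<phi> y"
    "\<And>a x. x \<in> X \<Longrightarrow> \<phi> (a \<odot> x) = a * \<phi> x"
    using \<phi> by (auto simp: dual_def linear_functional_on_def)
  obtain g where g: "linear g" and gX: "\<And>x. x \<in> X \<Longrightarrow> g x = \<phi> x \<bullet> 1"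
    and gle: "\<And>x. g x \<le> C * norm x"
  proof (rule Hahn_Banach_sublinear[of X "\<lambda>x. C * norm x" "\<lambda>x. \<phi> x \<bullet> 1"])
    show "subspace X" by (rule real_subspace[OF X])
    show "C * norm (x + y) \<le> C * norm x + C * norm y" for x y :: "'v \<Rightarrow>\<^sub>L 'k"
      using mult_left_mono[OF norm_triangle_ineq C0] by (simp add: distrib_left)
    show "\<phi> (r *\<^sub>R x) \<bullet> 1 = r * (\<phi> x \<bullet> 1)" if "x \<in> X" for r x
      using lin(2)[OF that, of "of_real r"]
      by (simp add: smult_blinfun_of_real flip: scaleR_conv_of_real)
    show "\<phi> x \<bullet> 1 \<le> C * norm x" if "x \<in> X" for x
    proof -
      have "\<phi> x \<bullet> 1 \<le> norm (\<phi> x) * norm (1 :: 'k)" by (rule norm_cauchy_schwarz)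
      then show ?thesis using dual_norm_apply[OF X \<phi> that] by (simp add: C_def)
    qed
  qed (auto simp: lin inner_add_left)
  have lin_g: "linear (\<lambda>a. g (a \<odot> x))" for x
    using linear_add[OF g] linear_cmul[OF g]
    by (intro linearI) (simp_all add: blinfun_over.scale_left_distrib scaleR_conv_of_real
        smult_blinfun_of_real flip: blinfun_over.scale_scale)
  have "\<forall>x. \<exists>b. \<forall>a. g (a \<odot> x) = (a * b) \<bullet> 1"
    using real_functional_is_inner_mult_one[OF lin_g] by (rule allI)
  then obtain \<Psi> where \<Psi>: "\<And>a x. g (a \<odot> x) = (a * \<Psi> x) \<bullet> 1"
    by metis
  have add: "\<Psi> (x + y) = \<Psi> x + \<Psi> y" for x y
    by (rule inner_mult_one_cancel)
      (simp add: blinfun_over.scale_right_distrib linear_add[OF g] distrib_left inner_add_left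
        flip: \<Psi>)
  have scale: "\<Psi> (c \<odot> x) = c * \<Psi> x" for c x
    by (rule inner_mult_one_cancel) (simp flip: \<Psi> mult.assoc)
  have ext: "\<Psi> x = \<phi> x" if "x \<in> X" for x
    by (rule inner_mult_one_cancel)
      (simp add: gX blinfun_over.subspace_scale[OF X] that lin flip: \<Psi>)
  have bound: "norm (\<Psi> x) \<le> C * norm x" for x
  proof (cases "\<Psi> x = 0")
    case True then show ?thesis using C0 by simp
  next
    case False
    \<comment> \<open>A scalar of norm one that rotates \<open>\<Psi> x\<close> onto the positive real axis.\<close>
    define u where "u = norm (\<Psi> x) *\<^sub>R inverse (\<Psi> x)"
    have "norm u = 1" using False by (simp add: u_def norm_inverse)
    have "norm (\<Psi> x) = (u * \<Psi> x) \<bullet> 1"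
      using False by (simp add: u_def dot_square_norm)
    also have "\<dots> = g (u \<odot> x)" by (rule \<Psi>[symmetric])
    also have "\<dots> \<le> C * norm (u \<odot> x)" by (rule gle)
    finally show ?thesis by (simp add: norm_smult_blinfun \<open>norm u = 1\<close>)
  qed
  define \<psi> where "\<psi> = restrict0 Y \<Psi>"
  have \<psi>: "\<psi> \<in> dual Y"
    unfolding \<psi>_def using bound
    by (intro restrict0_in_dual[OF Y subset_UNIV])
      (auto simp: linear_functional_on_def add scale)
  moreover have r: "restrict0 X \<psi> = \<phi>"
    using XY ext by (intro restrict0_id[OF \<phi>]) (auto simp: \<psi>_def restrict0_def)
  moreover have "dual_norm Y \<psi> \<le> C"
  proof (rule dual_norm_least[OF Y])
    fix x assume "x \<in> Y" "norm x \<le> 1"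
    then show "norm (\<psi> x) \<le> C"
      using bound[of x] mult_left_mono[OF \<open>norm x \<le> 1\<close> C0] by (simp add: \<psi>_def restrict0_def)
  qed
  ultimately show ?thesis
    using dual_norm_restrict0_le[OF XY X \<psi>] unfolding C_def by (intro bexI[of _ \<psi>]) auto
qed

section \<open>Absolutely continuous functionals\<close>

lemma subspace_dual_space: "blinfun_over.subspace (dual_space smul)"
  by (auto simp: blinfun_over.subspace_def dual_space_def blinfun.add_left algebra_simps)

text \<open>
  The weak-star topology is coarser than the norm topology, so a weak-star continuous functional is
  norm continuous, and continuity at \<open>0\<close> bounds a linear functional.
\<close>

lemma weak_star_continuous_imp_bounded:
  fixes W :: "('v::real_normed_vector \<Rightarrow>\<^sub>L 'k::{real_normed_field, euclidean_space}) set"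
  assumes W: "blinfun_over.subspace W" and lin: "linear_functional_on W \<Phi>"
    and cont: "continuous_map (weak_star_topology W) euclidean \<Phi>"
  shows "\<exists>C. \<forall>x\<in>W. norm (\<Phi> x) \<le> C * norm x"
proof -
  have add: "\<And>x y. x \<in> W \<Longrightarrow> y \<in> W \<Longrightarrow> \<Phi> (x + y) = \<Phi> x + \<Phi> y"
    and scale: "\<And>a x. x \<in> W \<Longrightarrow> \<Phi> (a \<odot> x) = a * \<Phi> x"
    using lin by (auto simp: linear_functional_on_def)
  have "continuous_on W (blinfun_apply :: ('v \<Rightarrow>\<^sub>L 'k) \<Rightarrow> _)"
    by (intro continuous_on_coordinatewise_then_product continuous_intros)
  then have "continuous_map (top_of_set W) (weak_star_topology W) (\<lambda>x. x)"
    unfolding weak_star_topology_def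
    by (intro continuous_map_pullback') (auto simp: o_def)
  from continuous_map_compose[OF this cont] have "continuous_on W \<Phi>"
    by (simp add: o_def)
  moreover have W0: "0 \<in> W" by (rule blinfun_over.subspace_0[OF W])
  moreover have \<Phi>0: "\<Phi> 0 = 0" using add[OF W0 W0] by simp
  ultimately obtain d where d: "d > 0" "\<And>x. x \<in> W \<Longrightarrow> norm x < d \<Longrightarrow> norm (\<Phi> x) < 1"
    unfolding continuous_on_iff by (metis dist_0_norm dist_commute zero_less_one)
  have "norm (\<Phi> x) \<le> (2 / d) * norm x" if x: "x \<in> W" for x
  proof (cases "x = 0")
    case True then show ?thesis by (simp add: \<Phi>0)
  next
    case False
    define c where "c = d / 2 / norm x"
    have c: "c > 0" using False d by (simp add: c_def)
    have "norm (of_real c \<odot> x) = c * norm x" using c by (simp add: norm_smult_blinfun)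
    also have "\<dots> < d" using False d by (simp add: c_def)
    finally have "norm (\<Phi> (of_real c \<odot> x)) < 1"
      using x by (intro d blinfun_over.subspace_scale[OF W])
    then have "c * norm (\<Phi> x) < 1" using c by (simp add: scale[OF x] norm_mult)
    then show ?thesis using False d by (simp add: c_def field_simps)
  qed
  then show ?thesis by blast
qed

lemma restrict0_AC:
  assumes "X \<subseteq> Y" "blinfun_over.subspace X" "\<psi> \<in> AC W Y"
  shows "restrict0 X \<psi> \<in> AC W X"
  using assms restrict0_dual[OF assms(1,2), of \<psi>] by (auto simp: AC_def restrict0_def)

lemma AC_extension:
  assumes W: "blinfun_over.subspace W" and Y: "blinfun_over.subspace Y"
    and XY: "X \<subseteq> Y" and YW: "Y \<subseteq> W" and \<phi>: "\<phi> \<in> AC W X"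
  shows "\<exists>\<psi>\<in>AC W Y. restrict0 X \<psi> = \<phi>"
proof -
  obtain \<Phi> where \<Phi>: "linear_functional_on W \<Phi>"
      "continuous_map (weak_star_topology W) euclidean \<Phi>"
    and ext: "\<And>x. x \<in> X \<Longrightarrow> \<Phi> x = \<phi> x" and \<phi>X: "\<phi> \<in> dual X"
    using \<phi> by (auto simp: AC_def)
  have "restrict0 Y \<Phi> \<in> dual Y"
    by (rule restrict0_in_dual[OF Y YW \<Phi>(1) weak_star_continuous_imp_bounded[OF W \<Phi>]])
  then have "restrict0 Y \<Phi> \<in> AC W Y"
    using \<Phi> by (auto simp: AC_def restrict0_def)
  moreover have "restrict0 X (restrict0 Y \<Phi>) = \<phi>"
    using XY ext by (intro restrict0_id[OF \<phi>X]) (auto simp: restrict0_def)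
  ultimately show ?thesis by blast
qed

section \<open>Lebesgue projections and the annihilator\<close>

text \<open>
  The singular functionals are defined as the range of \<open>I - L\<close>, which is the kernel of \<open>L\<close> because
  \<open>L\<close> is idempotent; the kernel is the convenient form for proving membership.
\<close>

lemma SG_iff_projection_zero:
  assumes X: "blinfun_over.subspace X" and L: "is_Lebesgue_projection W X L"
  shows "\<phi> \<in> SG W X \<longleftrightarrow> \<phi> \<in> dual X \<and> L \<phi> = (\<lambda>x. 0)"
proof
  assume "\<phi> \<in> SG W X"
  then obtain \<theta> where \<theta>: "\<theta> \<in> dual X" "\<phi> = (\<lambda>x. \<theta> x - L \<theta> x)"
    by (auto simp: SG_eq[OF X L])
  then show "\<phi> \<in> dual X \<and> L \<phi> = (\<lambda>x. 0)"
    using Lebesgue_projection_facts[OF L \<theta>(1)]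
      Lebesgue_projection_diff[OF L \<theta>(1) Lebesgue_projection_facts(2)[OF L \<theta>(1)]]
    by (simp add: dual_diff)
next
  assume \<phi>: "\<phi> \<in> dual X \<and> L \<phi> = (\<lambda>x. 0)"
  then have "\<phi> = (\<lambda>x. \<phi> x - L \<phi> x)" by simp
  with \<phi> show "\<phi> \<in> SG W X" unfolding SG_eq[OF X L] by blast
qed

lemma Lebesgue_projection_decomposition:
  assumes X: "blinfun_over.subspace X" and L: "is_Lebesgue_projection W X L"
    and a: "\<psi>\<^sub>a \<in> AC W X" and s: "\<psi>\<^sub>s \<in> SG W X"
  shows "L (\<lambda>x. \<psi>\<^sub>a x + \<psi>\<^sub>s x) = \<psi>\<^sub>a"
proof -
  have ad: "\<psi>\<^sub>a \<in> dual X" using a by (simp add: AC_def)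
  have sd: "\<psi>\<^sub>s \<in> dual X" and Ls: "L \<psi>\<^sub>s = (\<lambda>x. 0)"
    using s by (auto simp: SG_iff_projection_zero[OF X L])
  have "L (\<lambda>x. (\<psi>\<^sub>a x + \<psi>\<^sub>s x) - \<psi>\<^sub>s x) = (\<lambda>x. L (\<lambda>x. \<psi>\<^sub>a x + \<psi>\<^sub>s x) x - L \<psi>\<^sub>s x)"
    by (rule Lebesgue_projection_diff[OF L dual_add[OF ad sd] sd])
  then show ?thesis using Lebesgue_projection_facts(5)[OF L ad a] by (simp add: Ls)
qed

text \<open>Condition (ii), which quantifies over all splittings, becomes a statement about the operator \<open>L\<close>.\<close>

lemma annihilator_invariant_iff:
  assumes Y: "blinfun_over.subspace Y" and L: "is_Lebesgue_projection W Y L"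
  shows "(\<forall>\<psi>\<in>annihilator Y X. \<forall>\<psi>\<^sub>a\<in>AC W Y. \<forall>\<psi>\<^sub>s\<in>SG W Y.
      \<psi> = (\<lambda>y. \<psi>\<^sub>a y + \<psi>\<^sub>s y) \<longrightarrow> \<psi>\<^sub>a \<in> annihilator Y X \<and> \<psi>\<^sub>s \<in> annihilator Y X)
    \<longleftrightarrow> (\<forall>\<psi>\<in>annihilator Y X. L \<psi> \<in> annihilator Y X)" (is "?l \<longleftrightarrow> ?r")
proof
  assume l: ?l
  show ?r
  proof
    fix \<psi> assume \<psi>: "\<psi> \<in> annihilator Y X"
    then have d: "\<psi> \<in> dual Y" by (simp add: annihilator_def)
    have "(\<lambda>y. \<psi> y - L \<psi> y) \<in> SG W Y" using d unfolding SG_eq[OF Y L] by blast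
    then show "L \<psi> \<in> annihilator Y X"
      using l[rule_format, OF \<psi> Lebesgue_projection_facts(1)[OF L d]] by simp
  qed
next
  assume r: ?r
  show ?l
  proof (intro ballI impI)
    fix \<psi> \<psi>\<^sub>a \<psi>\<^sub>s
    assume \<psi>: "\<psi> \<in> annihilator Y X" and a: "\<psi>\<^sub>a \<in> AC W Y" and s: "\<psi>\<^sub>s \<in> SG W Y"
      and eq: "\<psi> = (\<lambda>y. \<psi>\<^sub>a y + \<psi>\<^sub>s y)"
    have "\<psi>\<^sub>a \<in> annihilator Y X"
      using r \<psi> Lebesgue_projection_decomposition[OF Y L a s] by (auto simp: eq)
    moreover have "\<psi>\<^sub>s \<in> dual Y" using s by (simp add: SG_iff_projection_zero[OF Y L])
    ultimately show "\<psi>\<^sub>a \<in> annihilator Y X \<and> \<psi>\<^sub>s \<in> annihilator Y X"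
      using \<psi> by (auto simp: eq annihilator_def)
  qed
qed

text \<open>
  If \<open>\<psi>\<close> vanishes on \<open>X\<close>, its two parts restrict to an absolutely continuous and a singular
  functional on \<open>X\<close> with sum \<open>0\<close>. The projection of \<open>X\<close> sends this sum to its absolutely continuous
  summand, which is therefore \<open>0\<close>.
\<close>

lemma compatible_imp_annihilator_invariant:
  assumes X: "blinfun_over.subspace X" and Y: "blinfun_over.subspace Y" and XY: "X \<subseteq> Y"
    and L: "is_Lebesgue_projection W Y L" and adm: "admits_Lebesgue_decomposition W X"
    and comp: "compatible W X Y" and \<psi>: "\<psi> \<in> annihilator Y X"
  shows "L \<psi> \<in> annihilator Y X"
proof -
  obtain K where K: "is_Lebesgue_projection W X K"
    using adm by (auto simp: admits_Lebesgue_decomposition_def)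
  have d: "\<psi> \<in> dual Y" and \<psi>0: "\<And>x. x \<in> X \<Longrightarrow> \<psi> x = 0" using \<psi> by (auto simp: annihilator_def)
  define \<psi>\<^sub>s where "\<psi>\<^sub>s = (\<lambda>y. \<psi> y - L \<psi> y)"
  have "\<psi>\<^sub>s \<in> SG W Y" using d unfolding SG_eq[OF Y L] \<psi>\<^sub>s_def by blast
  moreover have La: "L \<psi> \<in> AC W Y" by (rule Lebesgue_projection_facts(1)[OF L d])
  moreover have "\<psi> = (\<lambda>y. L \<psi> y + \<psi>\<^sub>s y)" by (simp add: \<psi>\<^sub>s_def)
  ultimately have a: "restrict0 X (L \<psi>) \<in> AC W X" and s: "restrict0 X \<psi>\<^sub>s \<in> SG W X"
    using comp d unfolding compatible_def by blast+
  have "restrict0 X (L \<psi>) = K (\<lambda>x. restrict0 X (L \<psi>) x + restrict0 X \<psi>\<^sub>s x)"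
    by (rule Lebesgue_projection_decomposition[OF X K a s, symmetric])
  also have "(\<lambda>x. restrict0 X (L \<psi>) x + restrict0 X \<psi>\<^sub>s x) = (\<lambda>x. 0)"
    using \<psi>0 by (auto simp: restrict0_def \<psi>\<^sub>s_def)
  also have "K (\<lambda>x. 0) = (\<lambda>x. 0)"
  proof -
    have z: "(\<lambda>x. 0) \<in> dual X" using dual_scale[OF restrict0_dual[OF XY X d], of 0] by simp
    then show ?thesis using Lebesgue_projection_diff[OF K z z] by simp
  qed
  finally have "restrict0 X (L \<psi>) = (\<lambda>x. 0)" .
  then show ?thesis
    using La by (auto simp: annihilator_def AC_def restrict0_def fun_eq_iff split: if_splits)
qed

text \<open>
  Two extensions of the same functional differ by an element of the annihilator, which \<open>L\<close> preserves.
  So the restriction of \<open>L \<psi>\<close> to \<open>X\<close> depends only on the restriction of \<open>\<psi>\<close>, which is the second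
  conclusion. It turns every algebraic property of \<open>L\<close> into one of \<open>K\<close>, although the chosen
  extension \<open>E\<close> need not be linear.
\<close>

lemma induced_Lebesgue_projection:
  fixes W X Y :: "('v::real_normed_vector \<Rightarrow>\<^sub>L 'k::{real_normed_field, euclidean_space}) set"
  assumes W: "blinfun_over.subspace W" and X: "blinfun_over.subspace X"
    and Y: "blinfun_over.subspace Y" and XY: "X \<subseteq> Y" and YW: "Y \<subseteq> W"
    and L: "is_Lebesgue_projection W Y L"
    and inv: "\<forall>\<psi>\<in>annihilator Y X. L \<psi> \<in> annihilator Y X"
  obtains K where "is_Lebesgue_projection W X K"
    and "\<And>\<psi>. \<psi> \<in> dual Y \<Longrightarrow> K (restrict0 X \<psi>) = restrict0 X (L \<psi>)"
proof -
  have "\<forall>\<phi>. \<exists>\<psi>. \<phi> \<in> dual X \<longrightarrow> \<psi> \<in> dual Y \<and> restrict0 X \<psi> = \<phi> \<and> dual_norm Y \<psi> = dual_norm X \<phi>"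
    using Hahn_Banach_dual[OF X Y XY] by blast
  then obtain E where E: "\<And>\<phi>. \<phi> \<in> dual X \<Longrightarrow> E \<phi> \<in> dual Y"
      "\<And>\<phi>. \<phi> \<in> dual X \<Longrightarrow> restrict0 X (E \<phi>) = \<phi>"
      "\<And>\<phi>. \<phi> \<in> dual X \<Longrightarrow> dual_norm Y (E \<phi>) = dual_norm X \<phi>"
    by metis
  define K where "K = (\<lambda>\<phi>. restrict0 X (L (E \<phi>)))"
  note Lf = Lebesgue_projection_facts[OF L] and rd = restrict0_dual[OF XY X]
  have radd: "restrict0 X (\<lambda>x. f x + g x) = (\<lambda>x. restrict0 X f x + restrict0 X g x)"
    and rscale: "restrict0 X (\<lambda>x. a * f x) = (\<lambda>x. a * restrict0 X f x)"
    and rdiff: "restrict0 X (\<lambda>x. f x - g x) = (\<lambda>x. restrict0 X f x - restrict0 X g x)"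
    for f g :: "('v \<Rightarrow>\<^sub>L 'k) \<Rightarrow> 'k" and a
    by (auto simp: restrict0_def)
  have Kres: "K (restrict0 X \<psi>) = restrict0 X (L \<psi>)" if \<psi>: "\<psi> \<in> dual Y" for \<psi>
  proof -
    define \<theta> where "\<theta> = E (restrict0 X \<psi>)"
    have \<theta>: "\<theta> \<in> dual Y" "restrict0 X \<theta> = restrict0 X \<psi>"
      using E rd[OF \<psi>] by (auto simp: \<theta>_def)
    have "\<theta> x = \<psi> x" if "x \<in> X" for x
      using fun_cong[OF \<theta>(2), of x] that by (simp add: restrict0_def)
    then have "(\<lambda>y. \<theta> y - \<psi> y) \<in> annihilator Y X"
      using dual_diff[OF \<theta>(1) \<psi>] by (simp add: annihilator_def)
    then have "L (\<lambda>y. \<theta> y - \<psi> y) \<in> annihilator Y X" using inv by blast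
    then have "\<forall>x\<in>X. L \<theta> x = L \<psi> x"
      by (simp add: annihilator_def Lebesgue_projection_diff[OF L \<theta>(1) \<psi>])
    then show ?thesis by (auto simp: K_def \<theta>_def restrict0_def)
  qed
  have KAC: "K \<phi> \<in> AC W X" if "\<phi> \<in> dual X" for \<phi>
    unfolding K_def by (rule restrict0_AC[OF XY X Lf(1)[OF E(1)[OF that]]])
  have KX: "K \<phi> \<in> dual X" if "\<phi> \<in> dual X" for \<phi>
    using KAC[OF that] by (simp add: AC_def)
  have Kfix: "K \<phi> = \<phi>" if \<phi>: "\<phi> \<in> AC W X" for \<phi>
  proof -
    obtain \<psi> where \<psi>: "\<psi> \<in> AC W Y" "restrict0 X \<psi> = \<phi>"
      using AC_extension[OF W Y XY YW \<phi>] by blast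
    have "\<psi> \<in> dual Y" using \<psi> by (simp add: AC_def)
    then show ?thesis using Kres[of \<psi>] Lf(5)[of \<psi>] \<psi> by simp
  qed
  have img: "K ` dual X = AC W X"
  proof
    show "AC W X \<subseteq> K ` dual X"
      using Kfix by (force simp: AC_def intro: rev_image_eqI)
  qed (use KAC in blast)
  have Kadd: "K (\<lambda>x. \<phi> x + \<psi> x) = (\<lambda>x. K \<phi> x + K \<psi> x)" if "\<phi> \<in> dual X" "\<psi> \<in> dual X" for \<phi> \<psi>
  proof -
    have "L (\<lambda>x. E \<phi> x + E \<psi> x) = (\<lambda>x. L (E \<phi>) x + L (E \<psi>) x)"
      using L E(1) that by (simp add: is_Lebesgue_projection_def)
    then show ?thesis
      using Kres[OF dual_add[OF E(1)[OF that(1)] E(1)[OF that(2)]]] E(2) that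
      by (simp add: radd K_def)
  qed
  have Kscale: "K (\<lambda>x. a * \<phi> x) = (\<lambda>x. a * K \<phi> x)" if "\<phi> \<in> dual X" for a \<phi>
  proof -
    have "L (\<lambda>x. a * E \<phi> x) = (\<lambda>x. a * L (E \<phi>) x)"
      using L E(1) that by (simp add: is_Lebesgue_projection_def)
    then show ?thesis
      using Kres[OF dual_scale[OF E(1)[OF that]]] E(2) that by (simp add: rscale K_def)
  qed
  have Knorm: "dual_norm X \<phi> = dual_norm X (K \<phi>) + dual_norm X (\<lambda>x. \<phi> x - K \<phi> x)"
    if \<phi>: "\<phi> \<in> dual X" for \<phi>
  proof (rule antisym)
    show "dual_norm X \<phi> \<le> dual_norm X (K \<phi>) + dual_norm X (\<lambda>x. \<phi> x - K \<phi> x)"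
      using dual_norm_add[OF X KX[OF \<phi>] dual_diff[OF \<phi> KX[OF \<phi>]]] by simp
    define \<theta> where "\<theta> = (\<lambda>y. E \<phi> y - L (E \<phi>) y)"
    have \<theta>: "\<theta> \<in> dual Y" unfolding \<theta>_def by (intro dual_diff E Lf \<phi>)
    have "restrict0 X \<theta> = (\<lambda>x. \<phi> x - K \<phi> x)"
      by (simp add: \<theta>_def rdiff E(2)[OF \<phi>] K_def)
    then have "dual_norm X (K \<phi>) + dual_norm X (\<lambda>x. \<phi> x - K \<phi> x)
        \<le> dual_norm Y (L (E \<phi>)) + dual_norm Y \<theta>"
      using dual_norm_restrict0_le[OF XY X Lf(2)[OF E(1)[OF \<phi>]]]
        dual_norm_restrict0_le[OF XY X \<theta>] by (simp add: K_def)
    also have "\<dots> = dual_norm X \<phi>"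
      using Lf(4)[OF E(1)[OF \<phi>]] E(3)[OF \<phi>] by (simp add: \<theta>_def)
    finally show "dual_norm X (K \<phi>) + dual_norm X (\<lambda>x. \<phi> x - K \<phi> x) \<le> dual_norm X \<phi>" .
  qed
  have "dual_norm X (K \<phi>) \<le> 1 * dual_norm X \<phi>" if "\<phi> \<in> dual X" for \<phi>
    using Knorm[OF that] dual_norm_nonneg[OF X dual_diff[OF that KX[OF that]]] by simp
  then have "is_Lebesgue_projection W X K"
    unfolding is_Lebesgue_projection_def
    by (intro conjI ballI allI exI[of _ 1] img Kadd Kscale Knorm Kfix KAC) auto
  then show ?thesis using Kres by (rule that)
qed

theorem theorem2p4:
  fixes smul :: "'k::{real_normed_field, euclidean_space} \<Rightarrow> 'v::real_normed_vector \<Rightarrow> 'v"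
    and W X Y :: "('v \<Rightarrow>\<^sub>L 'k) set"
  assumes "normed_space_over smul"
    and "W = dual_space smul"
    and "blinfun_over.subspace X" and "blinfun_over.subspace Y"
    and "X \<subseteq> Y" and "Y \<subseteq> W"
    and "admits_Lebesgue_decomposition W Y"
  shows "(admits_Lebesgue_decomposition W X \<and> compatible W X Y) \<longleftrightarrow>
    (\<forall>\<psi>\<in>annihilator Y X. \<forall>\<psi>\<^sub>a\<in>AC W Y. \<forall>\<psi>\<^sub>s\<in>SG W Y.
      \<psi> = (\<lambda>y. \<psi>\<^sub>a y + \<psi>\<^sub>s y) \<longrightarrow> \<psi>\<^sub>a \<in> annihilator Y X \<and> \<psi>\<^sub>s \<in> annihilator Y X)"
proof -
  note X = assms(3) and Y = assms(4) and XY = assms(5) and YW = assms(6)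
  have W: "blinfun_over.subspace W" unfolding assms(2) by (rule subspace_dual_space)
  obtain L where L: "is_Lebesgue_projection W Y L"
    using assms(7) by (auto simp: admits_Lebesgue_decomposition_def)
  show ?thesis
    unfolding annihilator_invariant_iff[OF Y L]
  proof
    assume "admits_Lebesgue_decomposition W X \<and> compatible W X Y"
    then show "\<forall>\<psi>\<in>annihilator Y X. L \<psi> \<in> annihilator Y X"
      using compatible_imp_annihilator_invariant[OF X Y XY L] by blast
  next
    assume inv: "\<forall>\<psi>\<in>annihilator Y X. L \<psi> \<in> annihilator Y X"
    obtain K where K: "is_Lebesgue_projection W X K"
      and Kres: "\<And>\<psi>. \<psi> \<in> dual Y \<Longrightarrow> K (restrict0 X \<psi>) = restrict0 X (L \<psi>)"
      using induced_Lebesgue_projection[OF W X Y XY YW L inv] by blast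
    have "restrict0 X \<psi> \<in> SG W X" if "\<psi> \<in> SG W Y" for \<psi>
    proof -
      have \<psi>: "\<psi> \<in> dual Y" "L \<psi> = (\<lambda>x. 0)"
        using that by (auto simp: SG_iff_projection_zero[OF Y L])
      then have "K (restrict0 X \<psi>) = (\<lambda>x. 0)" by (simp add: Kres[OF \<psi>(1)]) (simp add: restrict0_def)
      then show ?thesis
        using restrict0_dual[OF XY X \<psi>(1)] by (simp add: SG_iff_projection_zero[OF X K])
    qed
    then have "compatible W X Y"
      using restrict0_AC[OF XY X] by (auto simp: compatible_def)
    then show "admits_Lebesgue_decomposition W X \<and> compatible W X Y"
      using K by (auto simp: admits_Lebesgue_decomposition_def)
  qed
qed

end
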